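(* Let $E \subseteq \mathbb{R}^2$ be a $1$-rectifiable set with $\mathcal{H}^1(E) > 0$. (i) If $E$ is essentially $1$-flat, then the set of bad vantage points for $E$ is a line. (ii) If $E$ is not essentially $1$-flat, then there is at most one bad vantage point for $E$ in $\mathbb{R}^2$.
   Context: $\mathcal{H}^1$ denotes $1$-dimensional Hausdorff measure. A Borel set $E \subseteq \mathbb{R}^2$ is $1$-rectifiable if there are Lipschitz maps $f_j : \mathbb{R} \to \mathbb{R}^2$, $j \ge 1$, with $\mathcal{H}^1\big(E \setminus \bigcup_{j=1}^\infty f_j(\mathbb{R})\big) = 0$. A set $E \subseteq \mathbb{R}^2$ is essentially $1$-flat if there exists an affine line $P \subseteq \mathbb{R}^2$ such that $\mathcal{H}^1(E \setminus P) = 0$. For a vantage point $p \in \mathbb{R}^2$, the radial projection is the map $\pi_p : \mathbb{R}^2 \setminus \{p\} \to \mathbb{S}^1$, $\pi_p(z) = \frac{z-p}{|z-p|}$, and $\pi_p(E)$ denotes the image of $E \setminus \{p\}$ under $\pi_p$. A vantage point $p \in \mathbb{R}^2$ is good for $E$ if $\mathcal{H}^1(\pi_p(E)) > 0$, and bad otherwise. *)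

theory Defs
  imports "HOL-Analysis.Analysis"
begin

text \<open>
  One-dimensional Hausdorff (outer) measure, defined on all subsets of a metric space. The
  constant normalising \<open>diameter\<close> is 1 in dimension one, so on lines this is length. Covers are
  indexed by \<^typ>\<open>nat\<close>; empty members make finite covers a special case. The library's
  \<^const>\<open>diameter\<close> is unspecified on unbounded sets, so members of a cover are
  required to be bounded.
\<close>

definition hausdorff1_delta :: "real \<Rightarrow> 'a::metric_space set \<Rightarrow> ennreal" where
  "hausdorff1_delta \<delta> S =
     (INF A\<in>{A :: nat \<Rightarrow> 'a set. S \<subseteq> (\<Union>i. A i) \<and> (\<forall>i. bounded (A i) \<and> diameter (A i) \<le> \<delta>)}.
        \<Sum>i. ennreal (diameter (A i)))"

definition hausdorff1 :: "'a::metric_space set \<Rightarrow> ennreal" where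
  "hausdorff1 S = (SUP \<delta>\<in>{0<..}. hausdorff1_delta \<delta> S)"

definition rectifiable1 :: "(real^2) set \<Rightarrow> bool" where
  "rectifiable1 E \<longleftrightarrow>
     E \<in> sets borel \<and>
     (\<exists>f :: nat \<Rightarrow> real \<Rightarrow> real^2.
        (\<forall>j. \<exists>C. C-lipschitz_on UNIV (f j)) \<and> hausdorff1 (E - (\<Union>j. range (f j))) = 0)"

definition affine_line :: "(real^2) set \<Rightarrow> bool" where
  "affine_line L \<longleftrightarrow> affine L \<and> aff_dim L = 1"

definition essentially_flat1 :: "(real^2) set \<Rightarrow> bool" where
  "essentially_flat1 E \<longleftrightarrow> (\<exists>P. affine_line P \<and> hausdorff1 (E - P) = 0)"

text \<open>
  Only meaningful for \<open>z \<noteq> p\<close> (at \<open>z = p\<close> it has the junk value 0); hence \<open>p\<close> is removed from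
  the set being projected below. Measuring the image in the plane or in the unit circle with the
  restricted metric gives the same value.
\<close>

definition radial_proj :: "real^2 \<Rightarrow> real^2 \<Rightarrow> real^2" where
  "radial_proj p z = (z - p) /\<^sub>R norm (z - p)"

definition good_vantage :: "(real^2) set \<Rightarrow> real^2 \<Rightarrow> bool" where
  "good_vantage E p \<longleftrightarrow> hausdorff1 (radial_proj p ` (E - {p})) > 0"

abbreviation bad_vantage :: "(real^2) set \<Rightarrow> real^2 \<Rightarrow> bool" where
  "bad_vantage E p \<equiv> \<not> good_vantage E p"

end

theory Submission
  imports Defs
begin

text \<open>
  If \<open>E\<close> lies on a line \<open>P\<close> up to a null set, then from a vantage point on \<open>P\<close> the set \<open>P\<close> is seen
  in at most two directions, while the remaining null set has a null projection because radial
  projection is Lipschitz away from its centre. From a point off \<open>P\<close>, radial projection restricted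
  to \<open>P\<close> has a locally Lipschitz inverse, so a null projection would make \<open>E\<close> null.

  In the other case suppose that two points \<open>p \<noteq> q\<close> are bad, and let \<open>P\<close> be the line through them.
  Off \<open>P\<close>, a point is determined by the slopes at which it is seen from \<open>p\<close> and from \<open>q\<close>
  (\<open>triangulation_from_slopes\<close>), and in both directions this change of coordinates is locally
  Lipschitz. Since both projections of \<open>E\<close> are null, each piece of \<open>E - P\<close> on a short Lipschitz arc
  becomes a piece of a Lipschitz curve \<open>x \<mapsto> (g x, h x)\<close>, over a set \<open>A\<close> of parameters with both
  \<open>g ` A\<close> and \<open>h ` A\<close> negligible. Such a piece is null
  (\<open>hausdorff1_null_curve_if_projections_null\<close>). So \<open>E - P\<close> is null and \<open>E\<close> is essentially flat.

  The statement about curves is proved without differentiation. The number of solutions of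
  \<open>g x = y\<close> is bounded by an integrable function of \<open>y\<close> (half of Banach's indicatrix theorem,
  \<open>lipschitz_multiplicity_integrable\<close>), and its integral over a neighbourhood of a negligible set
  can be made arbitrarily small. This integral bounds the total variation of \<open>g\<close> over the
  preimage of the neighbourhood. Intersecting the preimages for \<open>g\<close> and \<open>h\<close> gives an open set of
  parameters, whose components cut the curve into pieces with an arbitrarily small sum of
  diameters.

  Only the vanishing of the Hausdorff measure matters throughout, and it is handled through
  covers whose diameters have a small sum.
\<close>

section \<open>Sets of vanishing length\<close>

lemma diameter_leI:
  fixes S :: "'a::metric_space set"
  assumes "0 \<le> d" and "\<And>x y. x \<in> S \<Longrightarrow> y \<in> S \<Longrightarrow> dist x y \<le> d"
  shows "diameter S \<le> d"
  using assms by (auto simp: diameter_def intro!: cSUP_least)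

lemma hausdorff1_null_cover:
  fixes S :: "'a::metric_space set"
  assumes "hausdorff1 S = 0" "e > 0"
  shows "\<exists>A::nat \<Rightarrow> 'a set. S \<subseteq> (\<Union>i. A i) \<and> (\<forall>i. bounded (A i)) \<and>
           (\<Sum>i. ennreal (diameter (A i))) \<le> ennreal e"
proof -
  have "hausdorff1_delta 1 S \<le> hausdorff1 S"
    unfolding hausdorff1_def by (rule SUP_upper) auto
  also have "\<dots> < ennreal e"
    using assms by simp
  finally show ?thesis
    unfolding hausdorff1_delta_def INF_less_iff by (blast intro: less_imp_le)
qed

text \<open>
  The mesh bound in the definition of the measure is automatic here: a cover whose diameters have
  sum at most \<open>e\<close> has only members of diameter at most \<open>e\<close>.
\<close>
lemma hausdorff1_nullI:
  fixes S :: "'a::metric_space set"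
  assumes cov: "\<And>e. e > 0 \<Longrightarrow> \<exists>A::nat \<Rightarrow> 'a set. S \<subseteq> (\<Union>i. A i) \<and> (\<forall>i. bounded (A i)) \<and>
              (\<Sum>i. ennreal (diameter (A i))) \<le> ennreal e"
  shows "hausdorff1 S = 0"
proof -
  have le: "hausdorff1_delta d S \<le> ennreal e" if de: "d > 0" "e > 0" for d e
  proof -
    obtain A :: "nat \<Rightarrow> 'a set" where A: "S \<subseteq> (\<Union>i. A i)" "\<And>i. bounded (A i)"
        and le: "(\<Sum>i. ennreal (diameter (A i))) \<le> ennreal (min d e)"
      using cov[of "min d e"] de by auto
    have "diameter (A i) \<le> d" for i
    proof -
      have "ennreal (diameter (A i)) \<le> (\<Sum>i. ennreal (diameter (A i)))"
        using sum_le_suminf[of "\<lambda>i. ennreal (diameter (A i))" "{i}"] by simp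
      then have "ennreal (diameter (A i)) \<le> ennreal (min d e)"
        using le by (rule order_trans)
      then show ?thesis
        using that by (simp add: ennreal_le_iff)
    qed
    then have "hausdorff1_delta d S \<le> (\<Sum>i. ennreal (diameter (A i)))"
      unfolding hausdorff1_delta_def using A by (intro INF_lower) auto
    also have "\<dots> \<le> ennreal e"
      using le by (rule order_trans) (simp add: ennreal_leI)
    finally show ?thesis .
  qed
  have "hausdorff1_delta d S \<le> 0" if "d > 0" for d
  proof (rule ennreal_le_epsilon)
    fix e :: real assume "0 < e"
    then show "hausdorff1_delta d S \<le> 0 + ennreal e"
      using le that by simp
  qed
  then have "hausdorff1 S \<le> 0"
    unfolding hausdorff1_def by (intro SUP_least) simp
  then show ?thesis by simp
qed

lemma hausdorff1_null_subset:
  assumes "hausdorff1 T = 0" "S \<subseteq> T"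
  shows "hausdorff1 S = 0"
proof (rule hausdorff1_nullI)
  fix e :: real assume "e > 0"
  then obtain A where A: "T \<subseteq> (\<Union>i. A i)" "\<And>i. bounded (A i)"
      "(\<Sum>i. ennreal (diameter (A i))) \<le> ennreal e"
    using hausdorff1_null_cover[OF assms(1)] by blast
  show "\<exists>A. S \<subseteq> (\<Union>i. A i) \<and> (\<forall>i. bounded (A i)) \<and> (\<Sum>i. ennreal (diameter (A i))) \<le> ennreal e"
    by (rule exI[of _ A]) (use A assms(2) in auto)
qed

lemma hausdorff1_null_UN_nat:
  fixes S :: "nat \<Rightarrow> 'a::metric_space set"
  assumes null: "\<And>n. hausdorff1 (S n) = 0"
  shows "hausdorff1 (\<Union>n. S n) = 0"
proof (rule hausdorff1_nullI)
  fix e :: real assume "e > 0"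
  have "\<exists>A. S n \<subseteq> (\<Union>i. A i) \<and> (\<forall>i. bounded (A i)) \<and>
          (\<Sum>i. ennreal (diameter (A i))) \<le> ennreal (e * (1/2) ^ Suc n)" for n
    using \<open>e > 0\<close> by (intro hausdorff1_null_cover null) simp
  then obtain A where A: "\<And>n. S n \<subseteq> (\<Union>i. A n i)" "\<And>n i. bounded (A n i)"
      and le: "\<And>n. (\<Sum>i. ennreal (diameter (A n i))) \<le> ennreal (e * (1/2) ^ Suc n)"
    by metis
  define B where "B = (\<lambda>i. case_prod A (prod_decode i))"
  have "(\<Sum>i. ennreal (diameter (B i))) = (\<Sum>n. \<Sum>i. ennreal (diameter (A n i)))"
    unfolding B_def
    by (rule suminf_ennreal_2dimen[where f = "\<lambda>p. ennreal (diameter (case_prod A p))"]) simp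
  also have "\<dots> \<le> (\<Sum>n. ennreal (e * (1/2) ^ Suc n))"
    by (intro suminf_le le) auto
  also have "\<dots> = ennreal e"
  proof -
    have "(\<lambda>n. e * (1/2) ^ Suc n) sums (e * 1)"
      by (intro sums_mult power_half_series)
    then show ?thesis
      using \<open>e > 0\<close> by (intro suminf_ennreal_eq) auto
  qed
  finally have "(\<Sum>i. ennreal (diameter (B i))) \<le> ennreal e" .
  moreover have "(\<Union>n. S n) \<subseteq> (\<Union>i. B i)"
  proof
    fix x assume "x \<in> (\<Union>n. S n)"
    then obtain n i where "x \<in> A n i"
      using A(1) by blast
    then have "x \<in> B (prod_encode (n, i))"
      by (simp add: B_def)
    then show "x \<in> (\<Union>i. B i)" by blast
  qed
  moreover have "bounded (B i)" for i
    using A(2) by (simp add: B_def split: prod.split)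
  ultimately show "\<exists>B. (\<Union>n. S n) \<subseteq> (\<Union>i. B i) \<and> (\<forall>i. bounded (B i)) \<and>
      (\<Sum>i. ennreal (diameter (B i))) \<le> ennreal e"
    by blast
qed

lemma hausdorff1_null_finite:
  assumes "finite S"
  shows "hausdorff1 S = 0"
proof (rule hausdorff1_nullI)
  fix e :: real assume "e > 0"
  obtain n and a :: "nat \<Rightarrow> 'a" where "S = a ` {i. i < n}"
    using finite_imp_nat_seg_image_inj_on[OF assms] by blast
  then have "S \<subseteq> range a" by blast
  then show "\<exists>A. S \<subseteq> (\<Union>i. A i) \<and> (\<forall>i. bounded (A i)) \<and> (\<Sum>i. ennreal (diameter (A i))) \<le> ennreal e"
    by (intro exI[of _ "\<lambda>i. {a i}"]) auto
qed

lemma hausdorff1_null_UN: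
  assumes "countable I" "\<And>i. i \<in> I \<Longrightarrow> hausdorff1 (S i) = 0"
  shows "hausdorff1 (\<Union>i\<in>I. S i) = 0"
proof (cases "I = {}")
  case True
  then show ?thesis by (simp add: hausdorff1_null_finite)
next
  case False
  have "(\<Union>n. S (from_nat_into I n)) = \<Union> (S ` range (from_nat_into I))"
    by (simp add: image_image)
  also have "\<dots> = (\<Union>i\<in>I. S i)"
    using False assms(1) by simp
  finally have "(\<Union>i\<in>I. S i) = (\<Union>n. S (from_nat_into I n))" ..
  moreover have "hausdorff1 (\<Union>n. S (from_nat_into I n)) = 0"
    using False by (intro hausdorff1_null_UN_nat assms(2) from_nat_into)
  ultimately show ?thesis by simp
qed

lemma hausdorff1_null_Un:
  assumes "hausdorff1 S = 0" "hausdorff1 T = 0"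
  shows "hausdorff1 (S \<union> T) = 0"
  using hausdorff1_null_UN[of "{S, T}" "\<lambda>X. X"] assms by auto

lemma hausdorff1_null_lipschitz_image:
  assumes "hausdorff1 S = 0" and lip: "C-lipschitz_on S f"
  shows "hausdorff1 (f ` S) = 0"
proof (rule hausdorff1_nullI)
  fix e :: real assume "e > 0"
  have C: "C \<ge> 0"
    by (rule lipschitz_on_nonneg[OF lip])
  \<comment> \<open>\<open>C + 1\<close> instead of \<open>C\<close> because \<open>C\<close> may be \<open>0\<close>.\<close>
  have e': "e / (C + 1) > 0"
    using \<open>e > 0\<close> C by simp
  obtain A where A: "S \<subseteq> (\<Union>i. A i)" "\<And>i. bounded (A i)"
      and le: "(\<Sum>i. ennreal (diameter (A i))) \<le> ennreal (e / (C + 1))"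
    using hausdorff1_null_cover[OF assms(1) e'] by blast
  \<comment> \<open>\<open>f\<close> is controlled only on \<open>S\<close>, so the members of the cover are first cut down to \<open>S\<close>.\<close>
  define B where "B = (\<lambda>i. f ` (S \<inter> A i))"
  have dist_B: "dist u v \<le> C * diameter (A i)" if uv: "u \<in> B i" "v \<in> B i" for i u v
  proof -
    obtain x y where xy: "x \<in> S" "y \<in> S" "x \<in> A i" "y \<in> A i" "u = f x" "v = f y"
      using uv unfolding B_def by blast
    have "dist (f x) (f y) \<le> C * dist x y"
      using lipschitz_onD[OF lip xy(1,2)] .
    also have "\<dots> \<le> C * diameter (A i)"
      using C A(2) xy by (intro mult_left_mono diameter_bounded_bound) auto
    finally show ?thesis using xy by simp
  qed
  have "diameter (B i) \<le> C * diameter (A i)" for i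
    using C A(2) by (intro diameter_leI dist_B mult_nonneg_nonneg diameter_ge_0)
  then have "(\<Sum>i. ennreal (diameter (B i))) \<le> (\<Sum>i. ennreal C * ennreal (diameter (A i)))"
    using C A(2) by (intro suminf_le) (auto simp: ennreal_mult[symmetric] diameter_ge_0 intro!: ennreal_leI)
  also have "\<dots> \<le> ennreal C * ennreal (e / (C + 1))"
    using le by (simp add: mult_left_mono)
  also have "\<dots> \<le> ennreal e"
  proof -
    have "C * (e / (C + 1)) \<le> e"
      using C \<open>e > 0\<close> by (simp add: field_simps)
    then show ?thesis
      using C \<open>e > 0\<close> by (simp add: ennreal_mult[symmetric] ennreal_leI)
  qed
  finally have "(\<Sum>i. ennreal (diameter (B i))) \<le> ennreal e" .
  moreover have "bounded (B i)" for i
    unfolding bounded_two_points by (blast intro: dist_B)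
  moreover have "f ` S \<subseteq> (\<Union>i. B i)"
    unfolding B_def using A(1) by blast
  ultimately show "\<exists>B. f ` S \<subseteq> (\<Union>i. B i) \<and> (\<forall>i. bounded (B i)) \<and>
      (\<Sum>i. ennreal (diameter (B i))) \<le> ennreal e"
    by blast
qed

lemma lipschitz_on_bounded_image:
  assumes lip: "C-lipschitz_on S f" and "bounded S"
  shows "bounded (f ` S)"
proof -
  have "dist (f x) (f y) \<le> C * diameter S" if "x \<in> S" "y \<in> S" for x y
  proof -
    have "dist (f x) (f y) \<le> C * dist x y"
      using that by (rule lipschitz_onD[OF lip])
    also have "\<dots> \<le> C * diameter S"
      using that lipschitz_on_nonneg[OF lip] \<open>bounded S\<close>
      by (intro mult_left_mono diameter_bounded_bound)
    finally show ?thesis .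
  qed
  then show ?thesis
    unfolding bounded_two_points by blast
qed

lemma lipschitz_on_quotient:
  fixes w :: "'a::metric_space \<Rightarrow> 'b::real_normed_vector" and v :: "'a \<Rightarrow> real"
  assumes w: "C-lipschitz_on S w" and v: "D-lipschitz_on S v"
    and B: "\<And>x. x \<in> S \<Longrightarrow> norm (w x) \<le> B" and m: "m > 0" "\<And>x. x \<in> S \<Longrightarrow> \<bar>v x\<bar> \<ge> m"
  shows "\<exists>L. L-lipschitz_on S (\<lambda>x. w x /\<^sub>R v x)"
proof (intro exI lipschitz_onI)
  fix x y assume xy: "x \<in> S" "y \<in> S"
  have v0: "v x \<noteq> 0" "v y \<noteq> 0"
    using m xy by force+
  have "(v y - v x) / (v x * v y) = inverse (v x) - inverse (v y)"
    using v0 by (simp add: divide_simps)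
  then have "w x /\<^sub>R v x - w y /\<^sub>R v y
          = (w x - w y) /\<^sub>R v x + ((v y - v x) / (v x * v y)) *\<^sub>R w y"
    by (simp add: scaleR_diff_right scaleR_diff_left)
  also have "norm \<dots> \<le> norm ((w x - w y) /\<^sub>R v x) + norm (((v y - v x) / (v x * v y)) *\<^sub>R w y)"
    by (rule norm_triangle_ineq)
  also have "\<dots> \<le> C * dist x y / m + (D * dist x y / (m * m)) * B"
  proof (rule add_mono)
    have "norm (w x - w y) \<le> C * dist x y"
      using lipschitz_onD[OF w xy] by (simp add: dist_norm)
    then have "norm (w x - w y) / \<bar>v x\<bar> \<le> C * dist x y / m"
      using m xy lipschitz_on_nonneg[OF w] by (intro frac_le) auto
    then show "norm ((w x - w y) /\<^sub>R v x) \<le> C * dist x y / m"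
      by (simp add: divide_inverse mult.commute)
    have "\<bar>v y - v x\<bar> \<le> D * dist x y"
      using lipschitz_onD[OF v xy] by (simp add: dist_norm abs_minus_commute)
    then have "\<bar>v y - v x\<bar> / (\<bar>v x\<bar> * \<bar>v y\<bar>) \<le> D * dist x y / (m * m)"
      using m xy lipschitz_on_nonneg[OF v] by (intro frac_le mult_mono) auto
    then have "\<bar>v y - v x\<bar> / (\<bar>v x\<bar> * \<bar>v y\<bar>) * norm (w y) \<le> (D * dist x y / (m * m)) * B"
      using m xy lipschitz_on_nonneg[OF v] B by (intro mult_mono) auto
    then show "norm (((v y - v x) / (v x * v y)) *\<^sub>R w y) \<le> (D * dist x y / (m * m)) * B"
      by (simp add: abs_mult)
  qed
  also have "\<dots> = (C / m + D * B / (m * m)) * dist x y"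
    by (simp add: algebra_simps)
  also have "\<dots> \<le> \<bar>C / m + D * B / (m * m)\<bar> * dist x y"
    by (rule mult_right_mono) (rule abs_ge_self, simp)
  finally show "dist (w x /\<^sub>R v x) (w y /\<^sub>R v y) \<le> \<bar>C / m + D * B / (m * m)\<bar> * dist x y"
    by (simp add: dist_norm)
qed simp

text \<open>
  A quotient of Lipschitz maps is Lipschitz where the numerator is bounded and the denominator is
  bounded away from \<open>0\<close>; countably many such pieces exhaust the domain. All projections and
  coordinate changes below have this form.
\<close>
lemma hausdorff1_null_quotient_image:
  fixes w :: "'a::metric_space \<Rightarrow> 'b::real_normed_vector" and v :: "'a \<Rightarrow> real"
  assumes null: "hausdorff1 S = 0" and w: "C-lipschitz_on S w" and v: "D-lipschitz_on S v"
    and nz: "\<And>x. x \<in> S \<Longrightarrow> v x \<noteq> 0"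
  shows "hausdorff1 ((\<lambda>x. w x /\<^sub>R v x) ` S) = 0"
proof -
  define T where "T = (\<lambda>n. {x \<in> S. norm (w x) \<le> real n \<and> \<bar>v x\<bar> \<ge> 1 / Suc n})"
  have cov: "S \<subseteq> (\<Union>n. T n)"
  proof
    fix x assume x: "x \<in> S"
    obtain n1 :: nat where n1: "norm (w x) \<le> real n1"
      using real_arch_simple by blast
    obtain n2 :: nat where n2: "inverse (of_nat (Suc n2)) < \<bar>v x\<bar>"
      using reals_Archimedean[of "\<bar>v x\<bar>"] nz[OF x] by auto
    have "1 / real (Suc (max n1 n2)) \<le> inverse (of_nat (Suc n2))"
      by (simp add: field_simps)
    then have "x \<in> T (max n1 n2)"
      using x n1 n2 by (auto simp: T_def)
    then show "x \<in> (\<Union>n. T n)" by blast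
  qed
  have "hausdorff1 ((\<lambda>x. w x /\<^sub>R v x) ` T n) = 0" for n
  proof -
    have sub: "T n \<subseteq> S" by (auto simp: T_def)
    obtain L where "L-lipschitz_on (T n) (\<lambda>x. w x /\<^sub>R v x)"
      using lipschitz_on_quotient[OF lipschitz_on_subset[OF w sub] lipschitz_on_subset[OF v sub],
          of n "1 / Suc n"]
      by (auto simp: T_def)
    with hausdorff1_null_subset[OF null sub] show ?thesis
      by (rule hausdorff1_null_lipschitz_image)
  qed
  then have "hausdorff1 (\<Union>n. (\<lambda>x. w x /\<^sub>R v x) ` T n) = 0"
    by (rule hausdorff1_null_UN_nat)
  moreover have "(\<lambda>x. w x /\<^sub>R v x) ` S \<subseteq> (\<Union>n. (\<lambda>x. w x /\<^sub>R v x) ` T n)"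
    using image_mono[OF cov, of "\<lambda>x. w x /\<^sub>R v x"] by (simp only: image_UN)
  ultimately show ?thesis
    by (rule hausdorff1_null_subset)
qed

lemma hausdorff1_null_imp_negligible:
  fixes S :: "real set"
  assumes "hausdorff1 S = 0"
  shows "negligible S"
  unfolding negligible_outer_le
proof (intro allI impI)
  fix e :: real assume "e > 0"
  then obtain A where A: "S \<subseteq> (\<Union>i. A i)" "\<And>i. bounded (A i)"
      and le: "(\<Sum>i. ennreal (diameter (A i))) \<le> ennreal (e / 2)"
    using hausdorff1_null_cover[OF assms, of "e / 2"] \<open>e > 0\<close> by auto
  define B where "B = (\<lambda>i. cball (SOME x. x \<in> A i) (diameter (A i)))"
  have "A i \<subseteq> B i" for i
  proof
    fix x assume "x \<in> A i"
    then have "(SOME x. x \<in> A i) \<in> A i"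
      by (rule someI)
    then have "dist (SOME x. x \<in> A i) x \<le> diameter (A i)"
      using \<open>x \<in> A i\<close> by (intro diameter_bounded_bound A(2))
    then show "x \<in> B i"
      by (simp add: B_def)
  qed
  then have sub: "S \<subseteq> (\<Union>i. B i)"
    by (intro order_trans[OF A(1)] UN_mono) auto
  have meas: "B i \<in> sets borel" for i
    by (simp add: B_def)
  have B: "emeasure lborel (B i) = 2 * ennreal (diameter (A i))" for i
    using diameter_ge_0[OF A(2)[of i]]
    by (simp add: B_def cball_eq_atLeastAtMost ennreal_mult)
  have "emeasure lborel (\<Union>i. B i) \<le> (\<Sum>i. emeasure lborel (B i))"
    using meas by (intro emeasure_subadditive_countably) auto
  also have "\<dots> = 2 * (\<Sum>i. ennreal (diameter (A i)))"
    by (simp add: B)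
  also have "\<dots> \<le> 2 * ennreal (e / 2)"
    by (rule mult_left_mono[OF le]) simp
  also have "\<dots> = ennreal (2 * (e / 2))"
    using \<open>e > 0\<close> by (simp only: ennreal_mult ennreal_numeral)
  finally have em: "emeasure lebesgue (\<Union>i. B i) \<le> ennreal e"
    using meas by simp
  then have "emeasure lebesgue (\<Union>i. B i) < \<infinity>"
    by (rule le_less_trans) simp
  then have "(\<Union>i. B i) \<in> lmeasurable"
    using meas by (intro fmeasurableI) auto
  moreover have "measure lebesgue (\<Union>i. B i) \<le> e"
    using em \<open>e > 0\<close> by (simp only: measure_def enn2real_leI less_imp_le)
  ultimately show "\<exists>T. S \<subseteq> T \<and> T \<in> lmeasurable \<and> measure lebesgue T \<le> e"
    using sub by blast
qed

section \<open>The multiplicity function of a Lipschitz function\<close>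

lemma ex_inj_on_dyadic_floor:
  fixes X :: "real set"
  assumes "finite X"
  shows "\<exists>n::nat. inj_on (\<lambda>x. \<lfloor>2 ^ n * x\<rfloor>) X"
proof -
  have "\<exists>m. \<forall>n\<ge>m. \<lfloor>2 ^ n * x\<rfloor> \<noteq> \<lfloor>2 ^ n * y\<rfloor>" if "x \<noteq> y" for x y :: real
  proof -
    obtain m where m: "1 / \<bar>x - y\<bar> < 2 ^ m"
      using real_arch_pow[of 2 "1 / \<bar>x - y\<bar>"] by auto
    have "\<lfloor>2 ^ n * x\<rfloor> \<noteq> \<lfloor>2 ^ n * y\<rfloor>" if "n \<ge> m" for n
    proof
      assume "\<lfloor>2 ^ n * x\<rfloor> = \<lfloor>2 ^ n * y\<rfloor>"
      then have "\<bar>2 ^ n * x - 2 ^ n * y\<bar> < 1"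
        by linarith
      moreover have "\<bar>2 ^ n * x - 2 ^ n * y\<bar> = 2 ^ n * \<bar>x - y\<bar>"
        by (simp add: abs_mult flip: right_diff_distrib)
      moreover have "2 ^ m * \<bar>x - y\<bar> \<le> 2 ^ n * \<bar>x - y\<bar>"
        using that by (intro mult_right_mono) auto
      moreover have "1 < 2 ^ m * \<bar>x - y\<bar>"
        using m \<open>x \<noteq> y\<close> by (simp add: pos_divide_less_eq)
      ultimately show False by linarith
    qed
    then show ?thesis by blast
  qed
  then have "\<forall>p\<in>X \<times> X. \<exists>m. \<forall>n\<ge>m. fst p \<noteq> snd p \<longrightarrow> \<lfloor>2 ^ n * fst p\<rfloor> \<noteq> \<lfloor>2 ^ n * snd p\<rfloor>"
    by blast
  then have "\<forall>p\<in>X \<times> X. eventually (\<lambda>n. fst p \<noteq> snd p \<longrightarrow> \<lfloor>2 ^ n * fst p\<rfloor> \<noteq> \<lfloor>2 ^ n * snd p\<rfloor>) sequentially"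
    by (simp only: eventually_sequentially)
  then have "eventually (\<lambda>n. \<forall>p\<in>X \<times> X. fst p \<noteq> snd p \<longrightarrow> \<lfloor>2 ^ n * fst p\<rfloor> \<noteq> \<lfloor>2 ^ n * snd p\<rfloor>) sequentially"
    using assms by (intro eventually_ball_finite) auto
  then obtain n where "\<forall>p\<in>X \<times> X. fst p \<noteq> snd p \<longrightarrow> \<lfloor>2 ^ n * fst p\<rfloor> \<noteq> \<lfloor>2 ^ n * snd p\<rfloor>"
    unfolding eventually_sequentially by blast
  then have "inj_on (\<lambda>x. \<lfloor>2 ^ n * x\<rfloor>) X"
    by (auto simp: inj_on_def)
  then show ?thesis ..
qed

text \<open>
  The majorant \<open>N y\<close> is the number of solutions of \<open>g x = y\<close>, computed as the increasing limit of the
  number of dyadic cells of side \<open>2\<^sup>-\<^sup>n\<close> whose image contains \<open>y\<close>. Each cell contributes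
  \<open>O(2\<^sup>-\<^sup>n)\<close> to the integral and there are \<open>O(2\<^sup>n)\<close> cells, so the integrals stay bounded.
\<close>
lemma lipschitz_multiplicity_integrable:
  fixes g :: "real \<Rightarrow> real"
  assumes lip: "C-lipschitz_on {c<..<d} g"
  obtains N :: "real \<Rightarrow> ennreal" where "N \<in> borel_measurable borel" "(\<integral>\<^sup>+y. N y \<partial>lborel) < \<infinity>"
    "\<And>X y. finite X \<Longrightarrow> X \<subseteq> {x \<in> {c<..<d}. g x = y} \<Longrightarrow> of_nat (card X) \<le> N y"
proof -
  define J where "J = (\<lambda>n k. {x \<in> {c<..<d}. \<lfloor>2 ^ n * x\<rfloor> = k})"
  define K where "K = (\<lambda>n::nat. {\<lfloor>2 ^ n * c\<rfloor>..\<lfloor>2 ^ n * d\<rfloor>})"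
  define F where "F = (\<lambda>y. {x \<in> {c<..<d}. g x = y})"
  define cnt where "cnt = (\<lambda>n y. \<Sum>k\<in>K n. indicator (g ` J n k) y :: ennreal)"
  have C: "C \<ge> 0"
    by (rule lipschitz_on_nonneg[OF lip])
  have floor_in_K: "(\<lambda>x. \<lfloor>2 ^ n * x\<rfloor>) ` F y \<subseteq> K n" for n y
    by (auto simp: F_def K_def intro!: floor_mono)
  have cnt_eq: "cnt n y = of_nat (card ((\<lambda>x. \<lfloor>2 ^ n * x\<rfloor>) ` F y))" for n y
  proof -
    have "cnt n y = (\<Sum>k\<in>K n. if k \<in> (\<lambda>x. \<lfloor>2 ^ n * x\<rfloor>) ` F y then 1 else 0)"
      unfolding cnt_def by (intro sum.cong) (auto simp: J_def F_def indicator_def)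
    also have "\<dots> = of_nat (card (K n \<inter> (\<lambda>x. \<lfloor>2 ^ n * x\<rfloor>) ` F y))"
      by (simp add: sum.If_cases K_def)
    finally show ?thesis
      using floor_in_K[of n y] by (simp add: Int_absorb1)
  qed
  have fin: "finite ((\<lambda>x. \<lfloor>2 ^ n * x\<rfloor>) ` F y)" for n y
    by (rule finite_subset[OF floor_in_K]) (simp add: K_def)
  have "cnt n y \<le> cnt (Suc n) y" for n y
  proof -
    \<comment> \<open>Each cell is the union of two cells of the next generation, so merging cells in pairs
       maps the cells counted at stage \<open>Suc n\<close> onto those counted at stage \<open>n\<close>.\<close>
    have half: "\<lfloor>2 ^ n * x\<rfloor> = \<lfloor>2 ^ Suc n * x\<rfloor> div 2" for x :: real
      using floor_divide_real_eq_div[of 2 "2 ^ Suc n * x"] by simp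
    have "(\<lambda>x. \<lfloor>2 ^ n * x\<rfloor>) ` F y = (\<lambda>k. k div 2) ` ((\<lambda>x. \<lfloor>2 ^ Suc n * x\<rfloor>) ` F y)"
      unfolding image_image by (intro image_cong refl half)
    then have "card ((\<lambda>x. \<lfloor>2 ^ n * x\<rfloor>) ` F y) \<le> card ((\<lambda>x. \<lfloor>2 ^ Suc n * x\<rfloor>) ` F y)"
      by (simp only: card_image_le[OF fin])
    then show ?thesis
      by (simp only: cnt_eq of_nat_le_iff)
  qed
  then have mono: "incseq cnt"
    by (intro incseq_SucI le_funI)
  have "is_interval (J n k)" for n k
    unfolding is_interval_1 J_def
    by (auto intro!: antisym) (metis floor_mono mult_left_mono zero_le_numeral zero_le_power)+
  then have conn: "connected (g ` J n k)" for n k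
    using lipschitz_on_continuous_on[OF lip]
    by (intro connected_continuous_image) (auto simp: J_def is_interval_connected_1 elim: continuous_on_subset)
  have meas: "g ` J n k \<in> sets borel" for n k
    using conn by (intro real_interval_borel_measurable) (simp add: is_interval_connected_1)
  have meas_cnt: "cnt n \<in> borel_measurable borel" for n
    unfolding cnt_def using meas by measurable
  have em: "emeasure lborel (g ` J n k) \<le> ennreal (2 * C / 2 ^ n)" for n k
  proof (cases "J n k = {}")
    case False
    then obtain x0 where x0: "x0 \<in> J n k" by blast
    have "g ` J n k \<subseteq> cball (g x0) (C / 2 ^ n)"
    proof
      fix y assume "y \<in> g ` J n k"
      then obtain x where x: "x \<in> J n k" "y = g x" by blast
      have "\<bar>2 ^ n * x0 - 2 ^ n * x\<bar> < 1"
        using x0 x(1) unfolding J_def mem_Collect_eq by linarith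
      moreover have "\<bar>2 ^ n * x0 - 2 ^ n * x\<bar> = 2 ^ n * dist x0 x"
        by (simp add: dist_real_def abs_mult flip: right_diff_distrib)
      ultimately have "dist x0 x \<le> 1 / 2 ^ n"
        by (simp add: field_simps)
      have "dist (g x0) (g x) \<le> C * dist x0 x"
        using x0 x by (intro lipschitz_onD[OF lip]) (auto simp: J_def)
      also have "\<dots> \<le> C * (1 / 2 ^ n)"
        using C \<open>dist x0 x \<le> 1 / 2 ^ n\<close> by (rule mult_left_mono[rotated])
      finally show "y \<in> cball (g x0) (C / 2 ^ n)"
        using x by simp
    qed
    then have "emeasure lborel (g ` J n k) \<le> emeasure lborel (cball (g x0) (C / 2 ^ n))"
      by (intro emeasure_mono) auto
    also have "\<dots> = ennreal (2 * C / 2 ^ n)"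
      using C by (simp add: cball_eq_atLeastAtMost)
    finally show ?thesis .
  qed simp
  have int: "(\<integral>\<^sup>+y. cnt n y \<partial>lborel) \<le> ennreal (2 * C * (\<bar>d - c\<bar> + 2))" for n
  proof -
    have "(\<integral>\<^sup>+y. cnt n y \<partial>lborel) = (\<Sum>k\<in>K n. emeasure lborel (g ` J n k))"
      unfolding cnt_def using meas by (subst nn_integral_sum) auto
    also have "\<dots> \<le> (\<Sum>k\<in>K n. ennreal (2 * C / 2 ^ n))"
      by (intro sum_mono em)
    also have "\<dots> = ennreal (real (card (K n)) * (2 * C / 2 ^ n))"
      using C by (simp add: ennreal_of_nat_eq_real_of_nat ennreal_mult[symmetric])
    also have "\<dots> \<le> ennreal (2 * C * (\<bar>d - c\<bar> + 2))"
    proof (rule ennreal_leI)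
      have "2 ^ n * d - 2 ^ n * c \<le> 2 ^ n * \<bar>d - c\<bar>"
        by (simp flip: right_diff_distrib)
      then have "real_of_int (\<lfloor>2 ^ n * d\<rfloor> - \<lfloor>2 ^ n * c\<rfloor> + 1) \<le> 2 ^ n * \<bar>d - c\<bar> + 2"
        by linarith
      moreover have "0 \<le> 2 ^ n * \<bar>d - c\<bar> + 2"
        by simp
      ultimately have "real (card (K n)) \<le> 2 ^ n * \<bar>d - c\<bar> + 2"
        by (cases "0 \<le> \<lfloor>2 ^ n * d\<rfloor> - \<lfloor>2 ^ n * c\<rfloor> + 1") (auto simp: K_def of_nat_nat)
      also have "\<dots> \<le> 2 ^ n * (\<bar>d - c\<bar> + 2)"
        by (simp add: algebra_simps)
      finally have "real (card (K n)) * (2 * C / 2 ^ n) \<le> 2 ^ n * (\<bar>d - c\<bar> + 2) * (2 * C / 2 ^ n)"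
        using C by (intro mult_right_mono) auto
      then show "real (card (K n)) * (2 * C / 2 ^ n) \<le> 2 * C * (\<bar>d - c\<bar> + 2)"
        by (simp add: mult_ac)
    qed
    finally show ?thesis .
  qed
  show ?thesis
  proof (rule that[of "\<lambda>y. SUP n. cnt n y"])
    show "(\<lambda>y. SUP n. cnt n y) \<in> borel_measurable borel"
      using meas_cnt by measurable
    have "(\<integral>\<^sup>+y. (SUP n. cnt n y) \<partial>lborel) = (SUP n. \<integral>\<^sup>+y. cnt n y \<partial>lborel)"
      using mono meas_cnt by (intro nn_integral_monotone_convergence_SUP) auto
    also have "\<dots> \<le> ennreal (2 * C * (\<bar>d - c\<bar> + 2))"
      by (intro SUP_least int)
    also have "\<dots> < \<infinity>"
      by simp
    finally show "(\<integral>\<^sup>+y. (SUP n. cnt n y) \<partial>lborel) < \<infinity>" .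
  next
    fix X y assume X: "finite X" "X \<subseteq> {x \<in> {c<..<d}. g x = y}"
    obtain n :: nat where inj: "inj_on (\<lambda>x. \<lfloor>2 ^ n * x\<rfloor>) X"
      using ex_inj_on_dyadic_floor[OF X(1)] by blast
    have "card X = card ((\<lambda>x. \<lfloor>2 ^ n * x\<rfloor>) ` X)"
      by (rule card_image[OF inj, symmetric])
    also have "\<dots> \<le> card ((\<lambda>x. \<lfloor>2 ^ n * x\<rfloor>) ` F y)"
      using X(2) by (intro card_mono fin image_mono) (simp add: F_def)
    finally have "of_nat (card X) \<le> cnt n y"
      by (simp only: cnt_eq of_nat_le_iff)
    also have "\<dots> \<le> (SUP n. cnt n y)"
      by (rule SUP_upper) simp
    finally show "of_nat (card X) \<le> (SUP n. cnt n y)" .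
  qed
qed

lemma diameter_le_emeasure_connected:
  fixes S :: "real set"
  assumes "connected S"
  shows "ennreal (diameter S) \<le> emeasure lborel S"
proof (cases "emeasure lborel S = \<infinity>")
  case False
  have meas: "S \<in> sets borel"
    using assms by (intro real_interval_borel_measurable) (simp add: is_interval_connected_1)
  have *: "y - x \<le> measure lborel S" if "x \<in> S" "y \<in> S" "x \<le> y" for x y
  proof -
    have "emeasure lborel {x..y} \<le> emeasure lborel S"
      using connected_contains_Icc[OF assms that(1,2)] meas by (intro emeasure_mono) auto
    then show ?thesis
      using that False by (simp add: emeasure_eq_ennreal_measure)
  qed
  have "diameter S \<le> measure lborel S"
  proof (rule diameter_leI)
    show "dist x y \<le> measure lborel S" if "x \<in> S" "y \<in> S" for x y
      using *[of x y] *[of y x] that by (cases "x \<le> y") (auto simp: dist_real_def)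
  qed simp
  then show ?thesis
    using False by (simp add: emeasure_eq_ennreal_measure ennreal_leI)
qed simp

text \<open>
  Over a fixed value \<open>y\<close> the images of disjoint intervals overlap at most as often as \<open>g\<close> takes the
  value \<open>y\<close>. Hence the total length of these images is at most the integral over \<open>U\<close> of the
  multiplicity of \<open>g\<close>, which is small for a suitable neighbourhood \<open>U\<close> of a negligible set.
\<close>
lemma lipschitz_small_variation_over_negligible:
  fixes g :: "real \<Rightarrow> real"
  assumes lip: "C-lipschitz_on {c<..<d} g" and neg: "negligible Z" and "e > 0"
  obtains U where "open U" "Z \<subseteq> U"
    "\<And>I :: nat \<Rightarrow> real set. disjoint_family I \<Longrightarrow> (\<And>n. connected (I n)) \<Longrightarrow> (\<And>n. I n \<subseteq> {c<..<d}) \<Longrightarrow>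
       (\<And>n. g ` I n \<subseteq> U) \<Longrightarrow> (\<Sum>n. ennreal (diameter (g ` I n))) \<le> ennreal e"
proof -
  obtain N :: "real \<Rightarrow> ennreal" where N: "N \<in> borel_measurable borel" "(\<integral>\<^sup>+y. N y \<partial>lborel) < \<infinity>"
    and mult: "\<And>X y. finite X \<Longrightarrow> X \<subseteq> {x \<in> {c<..<d}. g x = y} \<Longrightarrow> of_nat (card X) \<le> N y"
    using lipschitz_multiplicity_integrable[OF lip] by metis
  obtain Z' where Z': "Z' \<in> null_sets lborel" "Z \<subseteq> Z'"
    using neg unfolding negligible_iff_null_sets null_sets_completion_iff2 by blast
  define \<nu> where "\<nu> = density lborel N"
  have [measurable]: "N \<in> borel_measurable lborel"
    using N(1) by simp
  have sets_\<nu>: "sets \<nu> = sets borel"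
    by (simp add: \<nu>_def)
  have "emeasure \<nu> (space \<nu>) \<noteq> \<infinity>"
    using N(2) by (simp add: \<nu>_def emeasure_density)
  moreover have "Z' \<in> sets borel"
    using Z'(1) by auto
  ultimately have "emeasure \<nu> Z' = (INF U \<in> {U. Z' \<subseteq> U \<and> open U}. emeasure \<nu> U)"
    by (rule outer_regular[OF sets_\<nu>])
  moreover have "Z' \<in> null_sets \<nu>"
  proof -
    have "AE y in lborel. y \<in> Z' \<longrightarrow> N y = 0"
      using AE_not_in[OF Z'(1)] by (rule AE_mp) simp
    then show ?thesis
      unfolding \<nu>_def using Z'(1) by (subst null_sets_density_iff) auto
  qed
  ultimately have "(INF U \<in> {U. Z' \<subseteq> U \<and> open U}. emeasure \<nu> U) < ennreal e"
    using \<open>e > 0\<close> by (simp add: null_setsD1)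
  then obtain U where U: "Z' \<subseteq> U" "open U" "emeasure \<nu> U < ennreal e"
    unfolding INF_less_iff by blast
  show ?thesis
  proof (rule that[OF U(2)])
    show "Z \<subseteq> U"
      using Z'(2) U(1) by blast
  next
    fix I :: "nat \<Rightarrow> real set"
    assume disj: "disjoint_family I" and conn: "\<And>n. connected (I n)" and sub: "\<And>n. I n \<subseteq> {c<..<d}"
      and gU: "\<And>n. g ` I n \<subseteq> U"
    have conn_g: "connected (g ` I n)" for n
      using conn continuous_on_subset[OF lipschitz_on_continuous_on[OF lip] sub]
      by (intro connected_continuous_image)
    have meas: "g ` I n \<in> sets borel" for n
      using conn_g by (intro real_interval_borel_measurable) (simp add: is_interval_connected_1)
    have pointwise: "(\<Sum>n. indicator (g ` I n) y) \<le> N y * indicator U y" for y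
    proof (cases "y \<in> U")
      case False
      then have "indicator (g ` I n) y = (0::ennreal)" for n
        using gU by (auto simp: indicator_def)
      then show ?thesis by simp
    next
      case True
      have "(\<Sum>n<m. indicator (g ` I n) y) \<le> N y" for m
      proof -
        \<comment> \<open>Disjointness makes one chosen solution in each interval of \<open>M\<close> distinct from the others.\<close>
        define M where "M = {n\<in>{..<m}. y \<in> g ` I n}"
        have "\<forall>n\<in>M. \<exists>x. x \<in> I n \<and> g x = y"
          by (auto simp: M_def)
        then obtain x where x: "\<And>n. n \<in> M \<Longrightarrow> x n \<in> I n" "\<And>n. n \<in> M \<Longrightarrow> g (x n) = y"
          by metis
        have "inj_on x M"
          using x(1) disj unfolding inj_on_def disjoint_family_on_def by (metis IntI UNIV_I empty_iff)
        have "(\<Sum>n<m. indicator (g ` I n) y) = (of_nat (card M) :: ennreal)"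
          by (simp add: indicator_def sum.If_cases M_def Int_def)
        also have "card M = card (x ` M)"
          using \<open>inj_on x M\<close> by (simp add: card_image)
        also have "of_nat (card (x ` M)) \<le> N y"
        proof (rule mult)
          show "x ` M \<subseteq> {x \<in> {c<..<d}. g x = y}"
            using x sub by blast
        qed (simp add: M_def)
        finally show ?thesis .
      qed
      then show ?thesis
        using True by (simp add: suminf_eq_SUP SUP_least)
    qed
    have "(\<Sum>n. ennreal (diameter (g ` I n))) \<le> (\<Sum>n. emeasure lborel (g ` I n))"
      by (intro suminf_le diameter_le_emeasure_connected conn_g) auto
    also have "\<dots> = (\<integral>\<^sup>+y. (\<Sum>n. indicator (g ` I n) y) \<partial>lborel)"
      using meas by (subst nn_integral_suminf) auto
    also have "\<dots> \<le> (\<integral>\<^sup>+y. N y * indicator U y \<partial>lborel)"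
      by (intro nn_integral_mono pointwise)
    also have "\<dots> = emeasure \<nu> U"
      using U(2) unfolding \<nu>_def by (subst emeasure_density) auto
    also have "\<dots> \<le> ennreal e"
      using U(3) by simp
    finally show "(\<Sum>n. ennreal (diameter (g ` I n))) \<le> ennreal e" .
  qed
qed

section \<open>Curves with null coordinate projections\<close>

text \<open>
  These are the components of \<open>V\<close>, each listed once: enumerate the components of all rational points
  and replace every repetition by the empty set.
\<close>
lemma open_eq_disjoint_connected_UN:
  fixes V :: "real set"
  assumes "open V"
  obtains I :: "nat \<Rightarrow> real set"
  where "disjoint_family I" "\<And>n. connected (I n)" "(\<Union>n. I n) = V"
proof -
  define r :: "nat \<Rightarrow> real" where "r = from_nat_into \<rat>"
  have range_r: "range r = \<rat>"
    unfolding r_def using countable_rat by (intro range_from_nat_into) auto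
  define D where "D = (\<lambda>n. connected_component_set V (r n))"
  have "disjointed D n = {} \<or> disjointed D n = D n" for n
  proof (cases "\<exists>i<n. D i \<inter> D n \<noteq> {}")
    case True
    then obtain i where "i < n" "D i = D n"
      unfolding D_def connected_component_nonoverlap by blast
    then show ?thesis by (auto simp: disjointed_def)
  qed (auto simp: disjointed_def)
  then have conn: "connected (disjointed D n)" for n
    using connected_connected_component[of V "r n"] connected_empty unfolding D_def by metis
  have UN: "(\<Union>n. disjointed D n) = V"
    unfolding UN_disjointed_eq
  proof
    show "(\<Union>n. D n) \<subseteq> V"
      using connected_component_subset by (auto simp: D_def)
    show "V \<subseteq> (\<Union>n. D n)"
    proof
      fix x assume "x \<in> V"
      then have "open (connected_component_set V x)" "connected_component_set V x \<noteq> {}"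
        using open_connected_component[OF assms, of x] connected_component_eq_empty[of V x] by blast+
      then obtain q where q: "q \<in> \<rat>" "q \<in> connected_component_set V x"
        using open_Int_closure_eq_empty[of "connected_component_set V x" \<rat>] by (auto simp: Rats_closure_real)
      obtain n where "q = r n"
        using q(1) range_r by blast
      then have "connected_component V x (r n)"
        using q(2) by simp
      then have "x \<in> D n"
        unfolding D_def mem_Collect_eq by (rule connected_component_sym)
      then show "x \<in> (\<Union>n. D n)" by blast
    qed
  qed
  show ?thesis
    by (rule that[OF disjoint_family_disjointed conn UN])
qed

text \<open>
  The parameters at which both coordinates lie in small neighbourhoods of the two null
  projections form an open set; on its components the total variation of each coordinate is
  small, and hence so is the sum of the diameters of the corresponding pieces of the curve.
\<close>
lemma hausdorff1_null_curve_if_projections_null: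
  fixes g h :: "real \<Rightarrow> real"
  assumes g: "C-lipschitz_on {c<..<d} g" and h: "D-lipschitz_on {c<..<d} h"
    and A: "A \<subseteq> {c<..<d}" and neg: "negligible (g ` A)" "negligible (h ` A)"
  shows "hausdorff1 ((\<lambda>x. (g x, h x)) ` A) = 0"
proof (rule hausdorff1_nullI)
  fix e :: real assume "e > 0"
  then have e2: "e / 2 > 0" by simp
  obtain U where U: "open U" "g ` A \<subseteq> U"
    and Ug: "\<And>I :: nat \<Rightarrow> real set. disjoint_family I \<Longrightarrow> (\<And>n. connected (I n)) \<Longrightarrow>
       (\<And>n. I n \<subseteq> {c<..<d}) \<Longrightarrow> (\<And>n. g ` I n \<subseteq> U) \<Longrightarrow>
       (\<Sum>n. ennreal (diameter (g ` I n))) \<le> ennreal (e / 2)"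
    by (rule lipschitz_small_variation_over_negligible[OF g neg(1) e2]) blast
  obtain W where W: "open W" "h ` A \<subseteq> W"
    and Wh: "\<And>I :: nat \<Rightarrow> real set. disjoint_family I \<Longrightarrow> (\<And>n. connected (I n)) \<Longrightarrow>
       (\<And>n. I n \<subseteq> {c<..<d}) \<Longrightarrow> (\<And>n. h ` I n \<subseteq> W) \<Longrightarrow>
       (\<Sum>n. ennreal (diameter (h ` I n))) \<le> ennreal (e / 2)"
    by (rule lipschitz_small_variation_over_negligible[OF h neg(2) e2]) blast
  define V where "V = ({c<..<d} \<inter> g -` U) \<inter> ({c<..<d} \<inter> h -` W)"
  have "open V"
    unfolding V_def using lipschitz_on_continuous_on[OF g] lipschitz_on_continuous_on[OF h] U(1) W(1)
    by (intro open_Int continuous_open_preimage) auto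
  then obtain I :: "nat \<Rightarrow> real set"
    where I: "disjoint_family I" "\<And>n. connected (I n)" "(\<Union>n. I n) = V"
    by (rule open_eq_disjoint_connected_UN) (rule that)
  have sub: "I n \<subseteq> {c<..<d}" "g ` I n \<subseteq> U" "h ` I n \<subseteq> W" for n
    using I(3) unfolding V_def by blast+
  have bounded_I: "bounded (I n)" for n
    by (rule bounded_subset[OF _ sub(1)]) simp
  have bdd: "bounded (g ` I n)" "bounded (h ` I n)" for n
    by (rule lipschitz_on_bounded_image[OF lipschitz_on_subset[OF g sub(1)] bounded_I],
        rule lipschitz_on_bounded_image[OF lipschitz_on_subset[OF h sub(1)] bounded_I])
  define B where "B = (\<lambda>n. (\<lambda>x. (g x, h x)) ` I n)"
  have dist_B: "dist p q \<le> diameter (g ` I n) + diameter (h ` I n)" if "p \<in> B n" "q \<in> B n" for p q n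
  proof -
    have "dist p q \<le> dist (fst p) (fst q) + dist (snd p) (snd q)"
      unfolding dist_prod_def by (rule sqrt_sum_squares_le_sum) auto
    also have "\<dots> \<le> diameter (g ` I n) + diameter (h ` I n)"
      using that bdd by (intro add_mono diameter_bounded_bound) (auto simp: B_def)
    finally show ?thesis .
  qed
  have "diameter (B n) \<le> diameter (g ` I n) + diameter (h ` I n)" for n
    using bdd by (intro diameter_leI dist_B add_nonneg_nonneg diameter_ge_0)
  then have "(\<Sum>n. ennreal (diameter (B n))) \<le>
      (\<Sum>n. ennreal (diameter (g ` I n)) + ennreal (diameter (h ` I n)))"
    using bdd by (intro suminf_le) (auto simp: diameter_ge_0 simp flip: ennreal_plus intro!: ennreal_leI)
  also have "\<dots> = (\<Sum>n. ennreal (diameter (g ` I n))) + (\<Sum>n. ennreal (diameter (h ` I n)))"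
    by (rule suminf_add[symmetric]) auto
  also have "\<dots> \<le> ennreal (e / 2) + ennreal (e / 2)"
    using I sub by (intro add_mono Ug Wh) auto
  also have "\<dots> = ennreal e"
    using \<open>e > 0\<close> by (simp flip: ennreal_plus)
  finally have "(\<Sum>n. ennreal (diameter (B n))) \<le> ennreal e" .
  moreover have "bounded (B n)" for n
    unfolding bounded_two_points by (blast intro: dist_B)
  moreover have "(\<lambda>x. (g x, h x)) ` A \<subseteq> (\<Union>n. B n)"
  proof -
    have "A \<subseteq> (\<Union>n. I n)"
      unfolding I(3) V_def using A U(2) W(2) by blast
    then show ?thesis
      unfolding B_def by blast
  qed
  ultimately show "\<exists>B. (\<lambda>x. (g x, h x)) ` A \<subseteq> (\<Union>n. B n) \<and> (\<forall>n. bounded (B n)) \<and>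
      (\<Sum>n. ennreal (diameter (B n))) \<le> ennreal e"
    by blast
qed

section \<open>Lines in the plane\<close>

lemma orthogonal_frame_2:
  fixes e :: "real^2"
  assumes "e \<noteq> 0"
  obtains e' :: "real^2" where "e' \<noteq> 0" "e' \<bullet> e = 0"
    "\<And>w. (e \<bullet> e) *\<^sub>R w = (e \<bullet> w) *\<^sub>R e + (e' \<bullet> w) *\<^sub>R e'"
proof (rule that[of "vector [- e $ 2, e $ 1]"])
  show "vector [- e $ 2, e $ 1] \<noteq> (0 :: real^2)"
    using assms by (auto simp: vec_eq_iff forall_2)
qed (auto simp: vec_eq_iff forall_2 inner_vec_def sum_2 algebra_simps)

lemma affine_line_iff_hyperplane:
  "affine_line P \<longleftrightarrow> (\<exists>n \<beta>. n \<noteq> 0 \<and> P = {z. n \<bullet> z = \<beta>})"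
proof
  assume "affine_line P"
  then have "affine hull P = P" "aff_dim P = DIM(real^2) - 1"
    by (simp_all add: affine_line_def affine_hull_eq)
  then show "\<exists>n \<beta>. n \<noteq> 0 \<and> P = {z. n \<bullet> z = \<beta>}"
    by (metis aff_dim_eq_hyperplane)
qed (auto simp: affine_line_def affine_hyperplane)

section \<open>Radial projections\<close>

lemma bounded_linear_imp_lipschitz_on:
  assumes "bounded_linear h"
  shows "\<exists>L. L-lipschitz_on S h"
  by (rule bounded_linear.lipschitz_boundE[OF assms, of S]) (rule exI)

lemma lipschitz_on_inner_right: "\<exists>L. L-lipschitz_on S (\<lambda>x. n \<bullet> x)"
  by (rule bounded_linear_imp_lipschitz_on[OF bounded_linear_inner_right])

lemma lipschitz_on_norm_diff: "1-lipschitz_on S (\<lambda>z. norm (z - p))"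
  for p :: "'a::real_normed_vector"
proof (rule lipschitz_onI)
  show "dist (norm (x - p)) (norm (y - p)) \<le> 1 * dist x y" for x y
    using norm_triangle_ineq3[of "x - p" "y - p"] by (simp add: dist_norm)
qed simp

lemma hausdorff1_null_radial_proj:
  assumes "hausdorff1 S = 0" "p \<notin> S"
  shows "hausdorff1 (radial_proj p ` S) = 0"
proof -
  have lip: "1-lipschitz_on S (\<lambda>z. z - p)"
    by (rule lipschitz_onI) (auto simp: dist_norm)
  have nz: "norm (z - p) \<noteq> 0" if "z \<in> S" for z
    using that assms(2) by auto
  have "hausdorff1 ((\<lambda>z. (z - p) /\<^sub>R norm (z - p)) ` S) = 0"
    by (rule hausdorff1_null_quotient_image[OF assms(1) lip lipschitz_on_norm_diff nz])
  then show ?thesis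
    by (simp add: radial_proj_def[abs_def])
qed

lemma finite_radial_proj_collinear:
  assumes "collinear P" "p \<in> P"
  shows "finite (radial_proj p ` (P - {p}))"
proof -
  obtain u where u: "\<And>x y. x \<in> P \<Longrightarrow> y \<in> P \<Longrightarrow> \<exists>c. x - y = c *\<^sub>R u"
    using assms(1) unfolding collinear_def by blast
  have "radial_proj p z \<in> {u /\<^sub>R norm u, - (u /\<^sub>R norm u)}" if z: "z \<in> P - {p}" for z
  proof -
    obtain c where c: "z - p = c *\<^sub>R u"
      using u z assms(2) by blast
    with z have "c \<noteq> 0" by auto
    then show ?thesis
      unfolding radial_proj_def c by (cases "c > 0") (auto simp: field_simps)
  qed
  then have "radial_proj p ` (P - {p}) \<subseteq> {u /\<^sub>R norm u, - (u /\<^sub>R norm u)}"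
    by blast
  then show ?thesis
    by (rule finite_subset) simp
qed

text \<open>
  For \<open>p\<close> off the line, radial projection of the line is inverted by
  \<open>u \<mapsto> p + ((\<beta> - n \<bullet> p) / (n \<bullet> u)) u\<close>.
\<close>
lemma hausdorff1_null_if_radial_proj_null_on_line:
  assumes null: "hausdorff1 (radial_proj p ` S) = 0" and S: "S \<subseteq> {z. n \<bullet> z = \<beta>}" and p: "n \<bullet> p \<noteq> \<beta>"
  shows "hausdorff1 S = 0"
proof -
  define T where "T = radial_proj p ` S"
  define \<gamma> where "\<gamma> = \<beta> - n \<bullet> p"
  have \<gamma>: "\<gamma> \<noteq> 0"
    using p by (simp add: \<gamma>_def)
  have proj: "n \<bullet> radial_proj p z = \<gamma> / norm (z - p)" "radial_proj p z = (1 / norm (z - p)) *\<^sub>R (z - p)"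
    "z \<noteq> p" if "z \<in> S" for z
    using that S p by (auto simp: radial_proj_def \<gamma>_def inner_diff_right divide_inverse)
  have nz: "n \<bullet> u \<noteq> 0" if "u \<in> T" for u
    using that proj \<gamma> by (auto simp: T_def)
  obtain L where L: "L-lipschitz_on T (\<lambda>u. n \<bullet> u)"
    using lipschitz_on_inner_right by blast
  have "\<exists>M. M-lipschitz_on T (\<lambda>u. \<gamma> *\<^sub>R u + (n \<bullet> u) *\<^sub>R p)"
  proof -
    have "bounded_linear (\<lambda>u. \<gamma> *\<^sub>R u + (n \<bullet> u) *\<^sub>R p)"
      by (intro bounded_linear_add bounded_linear_scaleR_right
          bounded_linear_compose[OF bounded_linear_scaleR_left bounded_linear_inner_right])
    then show ?thesis
      by (rule bounded_linear_imp_lipschitz_on)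
  qed
  then obtain M where M: "M-lipschitz_on T (\<lambda>u. \<gamma> *\<^sub>R u + (n \<bullet> u) *\<^sub>R p)" ..
  have "hausdorff1 ((\<lambda>u. (\<gamma> *\<^sub>R u + (n \<bullet> u) *\<^sub>R p) /\<^sub>R (n \<bullet> u)) ` T) = 0"
    using null nz by (intro hausdorff1_null_quotient_image[OF _ M L]) (simp_all add: T_def)
  moreover have "S \<subseteq> (\<lambda>u. (\<gamma> *\<^sub>R u + (n \<bullet> u) *\<^sub>R p) /\<^sub>R (n \<bullet> u)) ` T"
  proof
    fix z assume z: "z \<in> S"
    have "\<gamma> *\<^sub>R radial_proj p z = (n \<bullet> radial_proj p z) *\<^sub>R (z - p)"
      unfolding proj(1)[OF z] by (subst proj(2)[OF z]) simp
    then have "\<gamma> *\<^sub>R radial_proj p z + (n \<bullet> radial_proj p z) *\<^sub>R p = (n \<bullet> radial_proj p z) *\<^sub>R z"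
      by (simp add: scaleR_diff_right)
    then have "z = (\<gamma> *\<^sub>R radial_proj p z + (n \<bullet> radial_proj p z) *\<^sub>R p) /\<^sub>R (n \<bullet> radial_proj p z)"
      using nz[of "radial_proj p z"] z by (simp add: T_def)
    then show "z \<in> (\<lambda>u. (\<gamma> *\<^sub>R u + (n \<bullet> u) *\<^sub>R p) /\<^sub>R (n \<bullet> u)) ` T"
      by (rule rev_image_eqI[rotated]) (use z in \<open>simp add: T_def\<close>)
  qed
  ultimately show ?thesis
    by (rule hausdorff1_null_subset)
qed

text \<open>
  The slope of \<open>z\<close> as seen from \<open>p\<close> depends only on the direction \<open>radial_proj p z\<close>, and as a
  function of the direction it is a quotient of Lipschitz functions.
\<close>
lemma hausdorff1_null_slope:
  assumes null: "hausdorff1 (radial_proj p ` S) = 0" and S: "\<And>z. z \<in> S \<Longrightarrow> e' \<bullet> (z - p) \<noteq> 0"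
  shows "hausdorff1 ((\<lambda>z. (e \<bullet> (z - p)) /\<^sub>R (e' \<bullet> (z - p))) ` S) = 0"
proof -
  define T where "T = radial_proj p ` S"
  obtain L M where "L-lipschitz_on T (\<lambda>u. e \<bullet> u)" "M-lipschitz_on T (\<lambda>u. e' \<bullet> u)"
    using lipschitz_on_inner_right by metis
  moreover have "e' \<bullet> u \<noteq> 0" if "u \<in> T" for u
    using that S by (force simp: T_def radial_proj_def)
  ultimately have null_T: "hausdorff1 ((\<lambda>u. (e \<bullet> u) /\<^sub>R (e' \<bullet> u)) ` T) = 0"
    using null by (intro hausdorff1_null_quotient_image) (auto simp: T_def)
  have eq: "(e \<bullet> radial_proj p z) /\<^sub>R (e' \<bullet> radial_proj p z) = (e \<bullet> (z - p)) /\<^sub>R (e' \<bullet> (z - p))"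
    if "z \<in> S" for z
  proof -
    have "z \<noteq> p"
      using S[OF that] by auto
    then show ?thesis
      by (simp add: radial_proj_def)
  qed
  have "(\<lambda>u. (e \<bullet> u) /\<^sub>R (e' \<bullet> u)) ` T = (\<lambda>z. (e \<bullet> (z - p)) /\<^sub>R (e' \<bullet> (z - p))) ` S"
    unfolding T_def image_image by (intro image_cong refl eq)
  then show ?thesis
    using null_T by simp
qed

section \<open>Two vantage points with null projections\<close>

text \<open>
  A point off the line through \<open>p\<close> and \<open>q = p + e\<close> is determined by the cotangents \<open>a\<close>, \<open>b\<close> of
  the angles at which it is seen from \<open>p\<close> and from \<open>q\<close>; here \<open>e'\<close> is \<open>e\<close> rotated by a right angle.
  With \<open>s = e \<bullet> (z - p)\<close> and \<open>t = e' \<bullet> (z - p)\<close> one has \<open>a = s / t\<close> and \<open>b = (s - e \<bullet> e) / t\<close>,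
  so \<open>a - b\<close> recovers \<open>t\<close> and then \<open>a\<close> recovers \<open>s\<close>.
\<close>
lemma triangulation_from_slopes:
  fixes p q e' z :: "'a::real_inner"
  defines "e \<equiv> q - p"
  defines "a \<equiv> (e \<bullet> (z - p)) / (e' \<bullet> (z - p))" and "b \<equiv> (e \<bullet> (z - q)) / (e' \<bullet> (z - q))"
  assumes frame: "\<And>w. (e \<bullet> e) *\<^sub>R w = (e \<bullet> w) *\<^sub>R e + (e' \<bullet> w) *\<^sub>R e'" and orth: "e' \<bullet> e = 0"
    and "p \<noteq> q" and z: "e' \<bullet> (z - p) \<noteq> 0"
  shows "a - b \<noteq> 0" "(a *\<^sub>R e + e' + (a - b) *\<^sub>R p) /\<^sub>R (a - b) = z"
proof -
  define t where "t = e' \<bullet> (z - p)"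
  have t: "t \<noteq> 0" "e' \<bullet> (z - q) = t"
    using z orth by (simp_all add: t_def e_def inner_diff_right)
  have ee: "e \<bullet> e \<noteq> 0"
    using \<open>p \<noteq> q\<close> by (simp add: e_def)
  have "a - b = (e \<bullet> (z - p) - e \<bullet> (z - q)) / t"
    unfolding a_def b_def t(2) t_def[symmetric] by (simp add: diff_divide_distrib)
  also have "e \<bullet> (z - p) - e \<bullet> (z - q) = e \<bullet> e"
    by (simp add: e_def flip: inner_diff_right)
  finally have ab: "a - b = (e \<bullet> e) / t" .
  then show nz: "a - b \<noteq> 0"
    using ee t by simp
  have "(a - b) *\<^sub>R (z - p) = (1 / t) *\<^sub>R ((e \<bullet> e) *\<^sub>R (z - p))"
    by (simp add: ab)
  also have "\<dots> = a *\<^sub>R e + e'"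
    using t unfolding frame t_def[symmetric] by (simp add: a_def t_def scaleR_add_right)
  finally have "(a - b) *\<^sub>R z = a *\<^sub>R e + e' + (a - b) *\<^sub>R p"
    by (simp only: scaleR_diff_right diff_eq_eq)
  then have "a *\<^sub>R e + e' + (a - b) *\<^sub>R p = (a - b) *\<^sub>R z" ..
  then show "(a *\<^sub>R e + e' + (a - b) *\<^sub>R p) /\<^sub>R (a - b) = z"
    using nz by simp
qed

text \<open>
  On an arc at distance bounded below from the line through \<open>p\<close> and \<open>q\<close> both slopes are Lipschitz
  functions of the parameter. The points of the arc with parameters in \<open>A\<close> therefore have a null
  image in slope coordinates, and they are recovered from it by triangulation.
\<close>
lemma hausdorff1_null_arc_if_two_radial_proj_null:
  fixes f :: "real \<Rightarrow> real^2"
  assumes lip: "C-lipschitz_on UNIV f" and "p \<noteq> q"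
    and frame: "\<And>w. ((q - p) \<bullet> (q - p)) *\<^sub>R w = ((q - p) \<bullet> w) *\<^sub>R (q - p) + (e' \<bullet> w) *\<^sub>R e'"
    and orth: "e' \<bullet> (q - p) = 0"
    and "m > 0" and away: "\<And>x. x \<in> {c<..<d} \<Longrightarrow> \<bar>e' \<bullet> (f x - p)\<bar> \<ge> m"
    and A: "A \<subseteq> {c<..<d}" and null: "hausdorff1 (radial_proj p ` f ` A) = 0" "hausdorff1 (radial_proj q ` f ` A) = 0"
  shows "hausdorff1 (f ` A) = 0"
proof -
  define e where "e = q - p"
  define a where "a = (\<lambda>r x. (e \<bullet> (f x - r)) /\<^sub>R (e' \<bullet> (f x - r)))"
  \<comment> \<open>The height above the line is the same for both vantage points, so the bound \<open>m\<close> serves both.\<close>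
  have q: "e' \<bullet> (f x - q) = e' \<bullet> (f x - p)" for x
    using orth by (simp add: inner_diff_right)
  have lip_a: "\<exists>L. L-lipschitz_on {c<..<d} (a r)" if r: "r = p \<or> r = q" for r
  proof -
    have "C-lipschitz_on {c<..<d} (\<lambda>x. f x - r)"
      using lipschitz_on_subset[OF lip subset_UNIV] by (auto simp: lipschitz_on_def dist_norm)
    moreover have "\<exists>L. L-lipschitz_on ((\<lambda>x. f x - r) ` {c<..<d}) (\<lambda>w. n \<bullet> w)" for n
      by (rule lipschitz_on_inner_right)
    ultimately have *: "\<exists>L. L-lipschitz_on {c<..<d} (\<lambda>x. n \<bullet> (f x - r))" for n
      using lipschitz_on_compose2 by blast
    obtain L M where L: "L-lipschitz_on {c<..<d} (\<lambda>x. e \<bullet> (f x - r))"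
      and M: "M-lipschitz_on {c<..<d} (\<lambda>x. e' \<bullet> (f x - r))"
      using * by metis
    have "bounded ((\<lambda>x. e \<bullet> (f x - r)) ` {c<..<d})"
      by (rule lipschitz_on_bounded_image[OF L]) simp
    then obtain B where "\<And>x. x \<in> {c<..<d} \<Longrightarrow> norm (e \<bullet> (f x - r)) \<le> B"
      unfolding bounded_iff by blast
    then show ?thesis
      unfolding a_def using r q away \<open>m > 0\<close> by (intro lipschitz_on_quotient[OF L M]) auto
  qed
  have neg: "negligible (a r ` A)" if r: "r = p \<or> r = q" for r
  proof (rule hausdorff1_null_imp_negligible)
    have "hausdorff1 ((\<lambda>z. (e \<bullet> (z - r)) /\<^sub>R (e' \<bullet> (z - r))) ` f ` A) = 0"
      using r null away A \<open>m > 0\<close> q by (intro hausdorff1_null_slope) fastforce+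
    then show "hausdorff1 (a r ` A) = 0"
      by (simp add: a_def image_image)
  qed
  define T where "T = (\<lambda>x. (a p x, a q x)) ` A"
  obtain L M where "L-lipschitz_on {c<..<d} (a p)" "M-lipschitz_on {c<..<d} (a q)"
    using lip_a by blast
  then have T: "hausdorff1 T = 0"
    unfolding T_def using neg A by (intro hausdorff1_null_curve_if_projections_null) auto
  define w where "w = (\<lambda>u::real \<times> real. fst u *\<^sub>R e + e' + (fst u - snd u) *\<^sub>R p)"
  define v where "v = (\<lambda>u::real \<times> real. fst u - snd u)"
  have tri: "v (a p x, a q x) \<noteq> 0" "w (a p x, a q x) /\<^sub>R v (a p x, a q x) = f x" if "x \<in> A" for x
  proof -
    have "e' \<bullet> (f x - p) \<noteq> 0"
      using away[of x] that A \<open>m > 0\<close> by auto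
    from triangulation_from_slopes[OF frame orth \<open>p \<noteq> q\<close> this]
    show "v (a p x, a q x) \<noteq> 0" "w (a p x, a q x) /\<^sub>R v (a p x, a q x) = f x"
      by (simp_all add: v_def w_def a_def e_def divide_inverse mult.commute)
  qed
  have v: "bounded_linear v"
    unfolding v_def by (intro bounded_linear_sub bounded_linear_fst bounded_linear_snd)
  then obtain Lv where Lv: "Lv-lipschitz_on T v"
    using bounded_linear_imp_lipschitz_on by blast
  have "bounded_linear (\<lambda>u::real \<times> real. fst u *\<^sub>R e + (fst u - snd u) *\<^sub>R p)"
    using v unfolding v_def
    by (intro bounded_linear_add bounded_linear_compose[OF bounded_linear_scaleR_left] bounded_linear_fst)
  then obtain Lw where "Lw-lipschitz_on T (\<lambda>u. fst u *\<^sub>R e + (fst u - snd u) *\<^sub>R p)"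
    using bounded_linear_imp_lipschitz_on by blast
  from lipschitz_on_add[OF this lipschitz_on_constant[of T e']]
  have Lw: "Lw-lipschitz_on T w"
    by (simp add: w_def[abs_def] add_ac)
  have "hausdorff1 ((\<lambda>u. w u /\<^sub>R v u) ` T) = 0"
    by (rule hausdorff1_null_quotient_image[OF T Lw Lv]) (use tri(1) in \<open>auto simp: T_def\<close>)
  also have "(\<lambda>u. w u /\<^sub>R v u) ` T = f ` A"
    unfolding T_def image_image by (intro image_cong refl tri(2))
  finally show ?thesis .
qed

text \<open>
  The set of parameters at which the curve is off the line is open, so it is exhausted by countably
  many intervals with rational endpoints on which the preceding lemma applies.
\<close>
lemma hausdorff1_null_off_line_if_two_radial_proj_null:
  fixes f :: "real \<Rightarrow> real^2"
  assumes lip: "C-lipschitz_on UNIV f" and "p \<noteq> q"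
    and frame: "\<And>w. ((q - p) \<bullet> (q - p)) *\<^sub>R w = ((q - p) \<bullet> w) *\<^sub>R (q - p) + (e' \<bullet> w) *\<^sub>R e'"
    and orth: "e' \<bullet> (q - p) = 0"
    and off: "\<And>x. x \<in> A \<Longrightarrow> e' \<bullet> (f x - p) \<noteq> 0"
    and null: "hausdorff1 (radial_proj p ` f ` A) = 0" "hausdorff1 (radial_proj q ` f ` A) = 0"
  shows "hausdorff1 (f ` A) = 0"
proof -
  define I where "I = {(c, d) \<in> \<rat> \<times> \<rat>. \<exists>m>0. \<forall>x\<in>{c<..<d}. \<bar>e' \<bullet> (f x - p)\<bar> \<ge> m}"
  have "countable I"
    by (rule countable_subset[of _ "\<rat> \<times> \<rat>"]) (auto simp: I_def countable_rat)
  moreover have "hausdorff1 (f ` (A \<inter> {fst k<..<snd k})) = 0" if k: "k \<in> I" for k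
  proof -
    obtain m where m: "m > 0" "\<And>x. x \<in> {fst k<..<snd k} \<Longrightarrow> \<bar>e' \<bullet> (f x - p)\<bar> \<ge> m"
      using k unfolding I_def by auto
    have "hausdorff1 (radial_proj r ` f ` (A \<inter> {fst k<..<snd k})) = 0" if "r = p \<or> r = q" for r
      using that null by (auto intro: hausdorff1_null_subset)
    then show ?thesis
      by (intro hausdorff1_null_arc_if_two_radial_proj_null[OF lip \<open>p \<noteq> q\<close> frame orth m]) auto
  qed
  ultimately have "hausdorff1 (\<Union>k\<in>I. f ` (A \<inter> {fst k<..<snd k})) = 0"
    by (rule hausdorff1_null_UN)
  moreover have "f ` A \<subseteq> (\<Union>k\<in>I. f ` (A \<inter> {fst k<..<snd k}))"
  proof
    fix z assume "z \<in> f ` A"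
    then obtain x0 where x0: "x0 \<in> A" "z = f x0" by blast
    define m where "m = \<bar>e' \<bullet> (f x0 - p)\<bar> / 2"
    have "m > 0"
      using off[OF x0(1)] by (simp add: m_def)
    have "continuous_on UNIV (\<lambda>x. \<bar>e' \<bullet> (f x - p)\<bar>)"
      by (intro continuous_intros lipschitz_on_continuous_on[OF lip])
    then have "open {x. m < \<bar>e' \<bullet> (f x - p)\<bar>}"
      by (rule open_Collect_less[OF continuous_on_const])
    moreover have "x0 \<in> {x. m < \<bar>e' \<bullet> (f x - p)\<bar>}"
      using \<open>m > 0\<close> by (simp add: m_def)
    ultimately obtain r where r: "r > 0" "ball x0 r \<subseteq> {x. m < \<bar>e' \<bullet> (f x - p)\<bar>}"
      by (rule openE) (rule that)
    obtain c where c: "c \<in> \<rat>" "x0 - r < c" "c < x0"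
      using Rats_dense_in_real[of "x0 - r" x0] r by auto
    obtain d where d: "d \<in> \<rat>" "x0 < d" "d < x0 + r"
      using Rats_dense_in_real[of x0 "x0 + r"] r by auto
    have "{c<..<d} \<subseteq> ball x0 r"
      using c d by (auto simp: dist_real_def)
    then have "\<forall>x\<in>{c<..<d}. \<bar>e' \<bullet> (f x - p)\<bar> \<ge> m"
      using r(2) by (auto intro: less_imp_le)
    then have "(c, d) \<in> I"
      using c d \<open>m > 0\<close> unfolding I_def by blast
    moreover have "z \<in> f ` (A \<inter> {fst (c, d)<..<snd (c, d)})"
      using x0 c d by auto
    ultimately show "z \<in> (\<Union>k\<in>I. f ` (A \<inter> {fst k<..<snd k}))"
      by blast
  qed
  ultimately show ?thesis
    by (rule hausdorff1_null_subset)
qed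

section \<open>Bad vantage points\<close>

theorem theorem3p1:
  fixes E :: "(real^2) set"
  assumes "rectifiable1 E"
    and "hausdorff1 E > 0"
  shows "(essentially_flat1 E \<longrightarrow> affine_line {p. bad_vantage E p}) \<and>
         (\<not> essentially_flat1 E \<longrightarrow> (\<exists>\<^sub>\<le>\<^sub>1 p. bad_vantage E p))"
proof (intro conjI impI)
  have bad_iff: "bad_vantage E p \<longleftrightarrow> hausdorff1 (radial_proj p ` (E - {p})) = 0" for p
    by (simp add: good_vantage_def)
  {
    assume "essentially_flat1 E"
    then obtain P where P: "affine_line P" "hausdorff1 (E - P) = 0"
      unfolding essentially_flat1_def by blast
    then obtain n \<beta> where n: "P = {z. n \<bullet> z = \<beta>}"
      using affine_line_iff_hyperplane by blast
    have "bad_vantage E p \<longleftrightarrow> p \<in> P" for p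
    proof
      assume "p \<in> P"
      have "collinear P"
        using P(1) by (simp add: affine_line_def collinear_aff_dim)
      then have "hausdorff1 (radial_proj p ` (P - {p})) = 0"
        using \<open>p \<in> P\<close> by (intro hausdorff1_null_finite finite_radial_proj_collinear)
      moreover have "hausdorff1 (radial_proj p ` (E - P)) = 0"
        using \<open>p \<in> P\<close> by (intro hausdorff1_null_radial_proj P(2)) simp
      ultimately have "hausdorff1 (radial_proj p ` (P - {p}) \<union> radial_proj p ` (E - P)) = 0"
        by (rule hausdorff1_null_Un)
      then show "bad_vantage E p"
        unfolding bad_iff by (rule hausdorff1_null_subset) blast
    next
      assume bad: "bad_vantage E p"
      show "p \<in> P"
      proof (rule ccontr)
        assume "p \<notin> P"
        then have "radial_proj p ` (E \<inter> P) \<subseteq> radial_proj p ` (E - {p})"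
          by blast
        then have "hausdorff1 (radial_proj p ` (E \<inter> P)) = 0"
          using bad unfolding bad_iff by (rule hausdorff1_null_subset[rotated])
        then have "hausdorff1 (E \<inter> P) = 0"
          by (rule hausdorff1_null_if_radial_proj_null_on_line) (use n \<open>p \<notin> P\<close> in auto)
        then have "hausdorff1 ((E \<inter> P) \<union> (E - P)) = 0"
          using P(2) by (rule hausdorff1_null_Un)
        then show False
          using assms(2) by (simp add: Int_Diff_Un)
      qed
    qed
    then have "{p. bad_vantage E p} = P"
      by blast
    then show "affine_line {p. bad_vantage E p}"
      using P(1) by simp
  next
    assume not_flat: "\<not> essentially_flat1 E"
    show "\<exists>\<^sub>\<le>\<^sub>1 p. bad_vantage E p"
      unfolding Uniq_def
    proof (intro allI impI, rule ccontr)
      fix p q assume bad: "bad_vantage E p" "bad_vantage E q" and "p \<noteq> q"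
      then have "q - p \<noteq> 0" by simp
      then obtain e' where e': "e' \<noteq> 0" "e' \<bullet> (q - p) = 0"
        "\<And>w. ((q - p) \<bullet> (q - p)) *\<^sub>R w = ((q - p) \<bullet> w) *\<^sub>R (q - p) + (e' \<bullet> w) *\<^sub>R e'"
        by (rule orthogonal_frame_2) (rule that)
      define P where "P = {z. e' \<bullet> z = e' \<bullet> p}"
      have pq: "p \<in> P" "q \<in> P"
        using e'(2) by (auto simp: P_def inner_diff_right)
      obtain f :: "nat \<Rightarrow> real \<Rightarrow> real^2" where f: "\<And>j. \<exists>C. C-lipschitz_on UNIV (f j)"
        and rest: "hausdorff1 (E - (\<Union>j. range (f j))) = 0"
        using assms(1) unfolding rectifiable1_def by blast
      \<comment> \<open>Removing \<open>P\<close> also removes \<open>p\<close> and \<open>q\<close>, so both projections of the image of \<open>A j\<close> are null.\<close>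
      define A where "A = (\<lambda>j. {x. f j x \<in> E - P})"
      have "hausdorff1 (f j ` A j) = 0" for j
      proof -
        obtain C where C: "C-lipschitz_on UNIV (f j)"
          using f by blast
        have "hausdorff1 (radial_proj r ` f j ` A j) = 0" if "r = p \<or> r = q" for r
        proof (rule hausdorff1_null_subset)
          show "hausdorff1 (radial_proj r ` (E - {r})) = 0"
            using that bad by (auto simp: bad_iff)
          show "radial_proj r ` f j ` A j \<subseteq> radial_proj r ` (E - {r})"
            using that pq by (intro image_mono) (auto simp: A_def)
        qed
        then show ?thesis
          by (intro hausdorff1_null_off_line_if_two_radial_proj_null[OF C \<open>p \<noteq> q\<close> e'(3,2)])
            (auto simp: A_def P_def inner_diff_right)
      qed
      then have "hausdorff1 ((\<Union>j. f j ` A j) \<union> (E - (\<Union>j. range (f j)))) = 0"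
        by (intro hausdorff1_null_Un hausdorff1_null_UN_nat rest)
      then have "hausdorff1 (E - P) = 0"
        by (rule hausdorff1_null_subset) (auto simp: A_def)
      moreover have "affine_line P"
        using e'(1) by (auto simp: P_def affine_line_iff_hyperplane)
      ultimately show False
        using not_flat unfolding essentially_flat1_def by blast
    qed
  }
qed

end
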